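(* Let $N\in\mathbb{N}$, $T>0$, $\alpha\in(1,2]$, $a_0,a_1\in\mathbb{R}^N$, $F\in(L^2(0,T))^N$ and $P\in(L^\infty(0,T))^{N\times N}$. Then the initial value problem $$\partial_t^\alpha(u-a_0-ta_1)=P(t)u(t)+F(t),\quad 0<t<T,\qquad u-a_0-ta_1\in(H_\alpha(0,T))^N,$$ admits a unique solution $u\in(L^2(0,T))^N$, and it satisfies $$\|u-a_0-ta_1\|_{(H_\alpha(0,T))^N}\le C\left(|a_0|_{\mathbb{R}^N}+|a_1|_{\mathbb{R}^N}+\|F\|_{(L^2(0,T))^N}\right)$$ for some constant $C=C(\|P\|_{(L^\infty(0,T))^{N\times N}},N,T,\alpha)>0$.
   Context: For $\gamma>0$ and $w\in L^2(0,T)$ (real-valued), $J^\gamma w(t)=\frac{1}{\Gamma(\gamma)}\int_0^t(t-s)^{\gamma-1}w(s)\,ds$; $J^\gamma$ is bounded and injective on $L^2(0,T)$. $H_\gamma(0,T):=J^\gamma L^2(0,T)$ with norm $\|v\|_{H_\gamma(0,T)}:=\|(J^\gamma)^{-1}v\|_{L^2(0,T)}$, and $\partial_t^\gamma:=(J^\gamma)^{-1}$ with domain $H_\gamma(0,T)$, acting componentwise on vector-valued functions. The equation is understood for almost every $t\in(0,T)$. *)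

theory Defs
  imports "HOL-Analysis.Analysis" "HOL-Probability.Essential_Supremum"
begin

text \<open>Elements of the Lebesgue spaces over \<open>(0,T)\<close> are represented by functions
  \<open>real \<Rightarrow> real\<close>, of which only the behaviour on \<open>(0,T)\<close> up to null sets matters; equality of
  two such elements is equality almost everywhere on \<open>(0,T)\<close>.\<close>

abbreviation leb :: "real \<Rightarrow> real measure" where
  "leb T \<equiv> lebesgue_on {0<..<T}"

definition L2 :: "real \<Rightarrow> (real \<Rightarrow> real) set" where
  "L2 T = {w. w \<in> borel_measurable (leb T) \<and> integrable (leb T) (\<lambda>t. (w t)\<^sup>2)}"

definition L2_norm :: "real \<Rightarrow> (real \<Rightarrow> real) \<Rightarrow> real" where
  "L2_norm T w = sqrt (LINT t|leb T. (w t)\<^sup>2)"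

definition Linf :: "real \<Rightarrow> (real \<Rightarrow> real) set" where
  "Linf T = {f. f \<in> borel_measurable (leb T) \<and> esssup (leb T) (\<lambda>t. ereal \<bar>f t\<bar>) < \<infinity>}"

definition Linf_norm :: "real \<Rightarrow> (real \<Rightarrow> real) \<Rightarrow> real" where
  "Linf_norm T f = real_of_ereal (esssup (leb T) (\<lambda>t. ereal \<bar>f t\<bar>))"

text \<open>For \<open>\<gamma> < 1\<close> and \<open>w \<in> L2 T\<close> the integral may diverge for a null set of \<open>t\<close>; there the
  Bochner integral is \<open>0\<close> by convention, which does not affect the almost-everywhere class.\<close>

definition J :: "real \<Rightarrow> (real \<Rightarrow> real) \<Rightarrow> real \<Rightarrow> real" where
  "J \<gamma> w t = 1 / Gamma \<gamma> * (LINT s|lebesgue_on {0<..<t}. (t - s) powr (\<gamma> - 1) * w s)"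

definition H :: "real \<Rightarrow> real \<Rightarrow> (real \<Rightarrow> real) set" where
  "H \<gamma> T = {v. \<exists>w\<in>L2 T. AE t in leb T. v t = J \<gamma> w t}"

text \<open>The inverse of \<open>J \<gamma>\<close> on its range \<open>H \<gamma> T\<close>. Since \<open>J \<gamma>\<close> is injective on \<open>L\<^sup>2(0,T)\<close>, the
  selected \<open>w\<close> is determined almost everywhere by \<open>v\<close>; outside \<open>H \<gamma> T\<close> the value is arbitrary.\<close>

definition frac_deriv :: "real \<Rightarrow> real \<Rightarrow> (real \<Rightarrow> real) \<Rightarrow> real \<Rightarrow> real" where
  "frac_deriv \<gamma> T v = (SOME w. w \<in> L2 T \<and> (AE t in leb T. v t = J \<gamma> w t))"

definition H_norm :: "real \<Rightarrow> real \<Rightarrow> (real \<Rightarrow> real) \<Rightarrow> real" where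
  "H_norm \<gamma> T v = L2_norm T (frac_deriv \<gamma> T v)"

text \<open>The product spaces. \<open>L2_set\<close> is the library's \<open>\<ell>\<^sup>2\<close> norm \<open>sqrt (\<Sum>i\<in>A. (f i)\<^sup>2)\<close> of a finite
  family, unrelated to \<open>L2\<close> above. The norm on \<open>N \<times> N\<close> matrices of bounded functions is the
  largest entry norm; any other product norm is equivalent with constants depending only on \<open>N\<close>.\<close>

definition L2_vec :: "real \<Rightarrow> (real \<Rightarrow> real^'n) set" where
  "L2_vec T = {u. \<forall>i. (\<lambda>t. u t $ i) \<in> L2 T}"

definition L2_vec_norm :: "real \<Rightarrow> (real \<Rightarrow> real^'n) \<Rightarrow> real" where
  "L2_vec_norm T u = L2_set (\<lambda>i. L2_norm T (\<lambda>t. u t $ i)) UNIV"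

definition Linf_mat :: "real \<Rightarrow> (real \<Rightarrow> real^'n^'n) set" where
  "Linf_mat T = {P. \<forall>i j. (\<lambda>t. P t $ i $ j) \<in> Linf T}"

definition Linf_mat_norm :: "real \<Rightarrow> (real \<Rightarrow> real^'n^'n) \<Rightarrow> real" where
  "Linf_mat_norm T P = Max (range (\<lambda>(i, j). Linf_norm T (\<lambda>t. P t $ i $ j)))"

definition H_vec :: "real \<Rightarrow> real \<Rightarrow> (real \<Rightarrow> real^'n) set" where
  "H_vec \<gamma> T = {v. \<forall>i. (\<lambda>t. v t $ i) \<in> H \<gamma> T}"

definition H_vec_norm :: "real \<Rightarrow> real \<Rightarrow> (real \<Rightarrow> real^'n) \<Rightarrow> real" where
  "H_vec_norm \<gamma> T v = L2_set (\<lambda>i. H_norm \<gamma> T (\<lambda>t. v t $ i)) UNIV"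

definition frac_deriv_vec :: "real \<Rightarrow> real \<Rightarrow> (real \<Rightarrow> real^'n) \<Rightarrow> real \<Rightarrow> real^'n" where
  "frac_deriv_vec \<gamma> T v t = (\<chi> i. frac_deriv \<gamma> T (\<lambda>s. v s $ i) t)"

definition is_solution ::
  "real \<Rightarrow> real \<Rightarrow> (real \<Rightarrow> real^'n^'n) \<Rightarrow> (real \<Rightarrow> real^'n) \<Rightarrow> real^'n \<Rightarrow> real^'n
    \<Rightarrow> (real \<Rightarrow> real^'n) \<Rightarrow> bool" where
  "is_solution \<alpha> T P F a0 a1 u \<longleftrightarrow>
     u \<in> L2_vec T \<and>
     (\<lambda>t. u t - a0 - t *\<^sub>R a1) \<in> H_vec \<alpha> T \<and>
     (AE t in leb T. frac_deriv_vec \<alpha> T (\<lambda>s. u s - a0 - s *\<^sub>R a1) t = P t *v u t + F t)"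

end

theory Submission
  imports Defs
begin

text \<open>Write \<open>u = a0 + t a1 + v\<close> with \<open>v = J \<alpha> w\<close>. The initial value problem is then the Volterra
equation \<open>w = P (a0 + t a1 + J \<alpha> w) + F\<close> for the fractional derivative \<open>w\<close>. Because \<open>\<alpha> > 1\<close>, the
kernel \<open>(t - s)\<^sup>\<alpha>\<^sup>-\<^sup>1 / \<Gamma>(\<alpha>)\<close> is continuous and bounded by a constant \<open>c\<close> on \<open>[0,T]\<close>; hence
\<open>J \<alpha> w\<close> is continuous for integrable \<open>w\<close> and \<open>|J \<alpha> w (t)| \<le> c \<integral>\<^sub>0\<^sup>t |w|\<close>. So the equation behaves
like an ordinary differential equation, and everything follows from measuring \<open>v\<close> in the sup
norm with weight \<open>e\<^sup>-\<^sup>\<mu>\<^sup>t\<close>: the integral operator gains a factor \<open>1 / \<mu>\<close>, and \<open>\<mu> = 2 c m\<close>, with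
\<open>m\<close> a Lipschitz constant of \<open>x \<mapsto> P x\<close>, makes it a contraction with factor \<open>1/2\<close>.

Existence is Banach's fixed point theorem in that norm for \<open>v\<close> (\<open>volterra_fixed_point\<close>).
Uniqueness and the estimate are the Gronwall bound \<open>volterra_gronwall\<close>, which controls \<open>v\<close> in the
sup norm by the \<open>L\<^sup>1\<close> norm of the data; inserting this in the equation bounds \<open>w\<close> pointwise by
the data, and squaring and integrating gives the \<open>L\<^sup>2\<close> bound, which is the bound in \<open>H\<^sub>\<alpha>\<close>.

The passage from the fixed point back to the initial value problem needs that the fractional
derivative of \<open>J \<alpha> w\<close> is \<open>w\<close>, that is, injectivity of \<open>J \<alpha>\<close> (\<open>J_inj\<close>). If \<open>J \<alpha> d = 0\<close>, convolving
with a further power of exponent \<open>2 - \<alpha>\<close> gives \<open>\<integral>\<^sub>0\<^sup>x (x - s)\<^sup>2 d(s) ds = 0\<close> for all \<open>x\<close>, by the Beta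
integral. Second difference quotients in \<open>x\<close> turn the kernel into a constant in the limit, so \<open>d\<close> has zero
integral over every \<open>(0,x)\<close> and vanishes almost everywhere.\<close>

section \<open>Volterra operators with a bounded continuous kernel\<close>

lemma finite_measure_leb: "finite_measure (leb T)"
  by (intro finite_measure_lebesgue_on) auto

lemma integrable_leb_const: "integrable (leb T) (\<lambda>_. c :: 'a :: {banach, second_countable_topology})"
  by (rule finite_measure.integrable_const[OF finite_measure_leb])

text \<open>The factor \<open>1 / \<mu>\<close> gained by integrating against the weight \<open>e\<^sup>\<mu>\<^sup>s\<close>. The cut-off at \<open>t\<close> is written as an
indicator, so that all integrals are over the fixed interval \<open>(0,T)\<close>.\<close>

lemma integral_exp_le:
  fixes \<mu> t T :: real
  assumes "0 \<le> t" "t \<le> T" "\<mu> > 0"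
  shows "integrable (leb T) (\<lambda>s. indicator {..<t} s * exp (\<mu> * s))"
    and "(LINT s|leb T. indicator {..<t} s * exp (\<mu> * s)) \<le> exp (\<mu> * t) / \<mu>"
proof -
  show int: "integrable (leb T) (\<lambda>s. indicator {..<t} s * exp (\<mu> * s))"
  proof (rule Bochner_Integration.integrable_bound[OF integrable_leb_const[of T "exp (\<mu> * t)"]])
    show "AE x in leb T. norm (indicator {..<t} x * exp (\<mu> * x)) \<le> norm (exp (\<mu> * t))"
      using assms by (auto simp: indicator_def)
  qed (intro measurable_restrict_space1 measurable_completion; measurable)
  have "((\<lambda>s. exp (\<mu> * s)) has_integral (exp (\<mu> * t) / \<mu> - exp (\<mu> * 0) / \<mu>)) {0..t}"
    using assms
    by (intro fundamental_theorem_of_calculus)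
       (auto intro!: derivative_eq_intros simp flip: has_real_derivative_iff_has_vector_derivative)
  then have "((\<lambda>s. exp (\<mu> * s)) has_integral (exp (\<mu> * t) / \<mu> - exp (\<mu> * 0) / \<mu>)) {0<..<t}"
    by (simp add: has_integral_Icc_iff_Ioo)
  then have "((\<lambda>s. if s \<in> {0<..<t} then exp (\<mu> * s) else 0) has_integral
      (exp (\<mu> * t) / \<mu> - exp (\<mu> * 0) / \<mu>)) UNIV"
    unfolding has_integral_restrict_UNIV .
  also have "(\<lambda>s. if s \<in> {0<..<t} then exp (\<mu> * s) else 0)
      = (\<lambda>s. if s \<in> {0<..<T} then indicator {..<t} s * exp (\<mu> * s) else 0)"
    using assms by (auto simp: fun_eq_iff indicator_def)
  finally have "((\<lambda>s. indicator {..<t} s * exp (\<mu> * s)) has_integral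
      (exp (\<mu> * t) / \<mu> - exp (\<mu> * 0) / \<mu>)) {0<..<T}"
    unfolding has_integral_restrict_UNIV .
  moreover have "((\<lambda>s. indicator {..<t} s * exp (\<mu> * s)) has_integral
      (LINT s|leb T. indicator {..<t} s * exp (\<mu> * s))) {0<..<T}"
    by (rule has_integral_integral_lebesgue_on[OF int]) auto
  ultimately have "(LINT s|leb T. indicator {..<t} s * exp (\<mu> * s)) = exp (\<mu> * t) / \<mu> - exp (\<mu> * 0) / \<mu>"
    by (rule has_integral_unique[symmetric])
  then show "(LINT s|leb T. indicator {..<t} s * exp (\<mu> * s)) \<le> exp (\<mu> * t) / \<mu>"
    using assms by simp
qed

text \<open>Requiring that \<open>k\<close> vanishes on the negative half-line lets \<open>\<integral>\<^sub>0\<^sup>t k(t - s) w(s) ds\<close> be written as an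
integral over \<open>(0,T)\<close>, whose domain does not depend on \<open>t\<close>; then continuity in \<open>t\<close> is dominated
convergence.\<close>

locale volterra_kernel =
  fixes k :: "real \<Rightarrow> real" and T c :: real
  assumes T_pos: "T > 0" and c_pos: "c > 0"
    and k_cont: "continuous_on UNIV k"
    and k_causal: "\<And>r. r \<le> 0 \<Longrightarrow> k r = 0"
    and k_bound: "\<And>r. r \<le> T \<Longrightarrow> \<bar>k r\<bar> \<le> c"
begin

definition V :: "(real \<Rightarrow> 'a::euclidean_space) \<Rightarrow> real \<Rightarrow> 'a" where
  "V w t = (LINT s|leb T. k (t - s) *\<^sub>R w s)"

lemma k_measurable: "(\<lambda>s. k (t - s)) \<in> borel_measurable (leb T)"
proof -
  have "continuous_on UNIV (\<lambda>s. k (t - s))"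
    by (intro continuous_intros continuous_on_compose2[OF k_cont]) auto
  then show ?thesis
    by (intro measurable_restrict_space1 measurable_completion) (simp add: borel_measurable_continuous_onI)
qed

lemma k_bound_causal:
  assumes "t \<le> T" "0 < s"
  shows "\<bar>k (t - s)\<bar> \<le> c * indicator {..<t} s"
  using k_bound[of "t - s"] k_causal[of "t - s"] assms by (auto simp: indicator_def)

lemma integrable_V:
  fixes w :: "real \<Rightarrow> 'a::euclidean_space"
  assumes "integrable (leb T) w" "t \<le> T"
  shows "integrable (leb T) (\<lambda>s. k (t - s) *\<^sub>R w s)"
proof (rule Bochner_Integration.integrable_bound)
  show "integrable (leb T) (\<lambda>s. c * norm (w s))" using assms by simp
  show "AE s in leb T. norm (k (t - s) *\<^sub>R w s) \<le> norm (c * norm (w s))"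
    using k_bound[of "t - s" for s] assms c_pos
    by (intro AE_I2) (auto simp: abs_mult intro!: mult_right_mono)
qed (use assms k_measurable in measurable)

lemma V_diff:
  assumes "integrable (leb T) w" "integrable (leb T) w'" "t \<le> T"
  shows "V (\<lambda>s. w s - w' s) t = V w t - V w' t"
  unfolding V_def using integrable_V[OF assms(1,3)] integrable_V[OF assms(2,3)]
  by (simp add: scaleR_right_diff_distrib)

lemma V_continuous:
  fixes w :: "real \<Rightarrow> 'a::euclidean_space"
  assumes w: "integrable (leb T) w"
  shows "continuous_on {0..T} (V w)"
  unfolding continuous_on_sequentially
proof (intro allI ballI impI)
  fix x a assume a: "a \<in> {0..T}" and x: "(\<forall>n. x n \<in> {0..T}) \<and> x \<longlonglongrightarrow> a"
  show "(V w \<circ> x) \<longlonglongrightarrow> V w a"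
    unfolding V_def comp_def
  proof (rule integral_dominated_convergence[where w = "\<lambda>s. c * norm (w s)"])
    show "AE s in leb T. (\<lambda>i. k (x i - s) *\<^sub>R w s) \<longlonglongrightarrow> k (a - s) *\<^sub>R w s"
    proof (intro AE_I2 tendsto_scaleR tendsto_const)
      fix s
      show "(\<lambda>i. k (x i - s)) \<longlonglongrightarrow> k (a - s)"
        by (rule continuous_on_tendsto_compose[OF k_cont]) (use x in \<open>auto intro!: tendsto_intros\<close>)
    qed
    show "\<And>i. AE s in leb T. norm (k (x i - s) *\<^sub>R w s) \<le> c * norm (w s)"
    proof (rule AE_I2)
      fix i s assume "s \<in> space (leb T)"
      then have "x i - s \<le> T" using x[THEN conjunct1, rule_format, of i] by auto
      then show "norm (k (x i - s) *\<^sub>R w s) \<le> c * norm (w s)"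
        by (auto intro!: mult_right_mono k_bound)
    qed
  qed (use w in \<open>auto intro!: borel_measurable_scaleR k_measurable\<close>)
qed

text \<open>The one estimate behind both existence and the a priori bound: an integrand that grows like
\<open>S e\<^sup>\<mu>\<^sup>s\<close> is mapped to a function that grows like \<open>(c S / \<mu>) e\<^sup>\<mu>\<^sup>t\<close>, so a large \<open>\<mu>\<close> makes the operator
small.\<close>

lemma V_exp_bound:
  fixes w :: "real \<Rightarrow> 'a::euclidean_space"
  assumes w: "integrable (leb T) w" and f: "integrable (leb T) f" "\<And>s. f s \<ge> 0"
    and "S \<ge> 0" "\<mu> > 0" and t: "0 \<le> t" "t \<le> T"
    and le: "AE s in leb T. norm (w s) \<le> S * exp (\<mu> * s) + f s"
  shows "norm (V w t) \<le> c * (LINT s|leb T. f s) + c * S / \<mu> * exp (\<mu> * t)"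
proof -
  let ?e = "\<lambda>s. indicator {..<t} s * exp (\<mu> * s)"
  note e = integral_exp_le[OF t \<open>\<mu> > 0\<close>]
  have "norm (V w t) \<le> (LINT s|leb T. norm (k (t - s) *\<^sub>R w s))"
    unfolding V_def by (rule integral_norm_bound)
  also have "\<dots> \<le> (LINT s|leb T. c * f s + c * S * ?e s)"
  proof (rule integral_mono_AE)
    show "AE s in leb T. norm (k (t - s) *\<^sub>R w s) \<le> c * f s + c * S * ?e s"
      using le AE_space
    proof eventually_elim
      case (elim s)
      have "norm (k (t - s) *\<^sub>R w s) \<le> (c * indicator {..<t} s) * (S * exp (\<mu> * s) + f s)"
        unfolding norm_scaleR using elim k_bound_causal[of t s] t c_pos
        by (intro mult_mono) (auto simp: space_restrict_space)
      also have "\<dots> \<le> c * f s + c * S * ?e s"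
        using c_pos f(2)[of s] by (auto simp: indicator_def algebra_simps)
      finally show ?case .
    qed
  qed (use integrable_norm[OF integrable_V[OF w t(2)]] f e(1) in \<open>simp_all del: norm_scaleR\<close>)
  also have "\<dots> = c * (LINT s|leb T. f s) + c * S * (LINT s|leb T. ?e s)"
    using f e(1) by simp
  also have "\<dots> \<le> c * (LINT s|leb T. f s) + c * S * (exp (\<mu> * t) / \<mu>)"
    using e(2) c_pos \<open>S \<ge> 0\<close> by (intro add_left_mono mult_left_mono) auto
  finally show ?thesis by simp
qed

text \<open>At a maximum point of \<open>e\<^sup>-\<^sup>\<mu>\<^sup>s |V w s|\<close> with \<open>\<mu> = 2 c m\<close>, \<open>V_exp_bound\<close> bounds this maximum by
half of itself plus \<open>c \<integral> f\<close>, and the half is absorbed on the left. The maximum exists because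
\<open>V w\<close> is continuous on the compact interval.\<close>

lemma volterra_gronwall:
  fixes w :: "real \<Rightarrow> 'a::euclidean_space"
  assumes w: "integrable (leb T) w" and f: "integrable (leb T) f" "\<And>s. f s \<ge> 0"
    and "m > 0" and t: "0 \<le> t" "t \<le> T"
    and le: "AE s in leb T. norm (w s) \<le> m * norm (V w s) + f s"
  shows "norm (V w t) \<le> 2 * c * exp (2 * c * m * T) * (LINT s|leb T. f s)"
proof -
  define \<mu> where "\<mu> = 2 * c * m"
  have \<mu>: "\<mu> > 0" using c_pos \<open>m > 0\<close> by (simp add: \<mu>_def)
  define A where "A = (LINT s|leb T. f s)"
  have A: "A \<ge> 0" unfolding A_def using f(2) by simp
  let ?z = "\<lambda>s. exp (- \<mu> * s) * norm (V w s)"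
  have "continuous_on {0..T} ?z"
    by (intro continuous_intros V_continuous w)
  then obtain x where x: "x \<in> {0..T}" and max: "\<And>s. s \<in> {0..T} \<Longrightarrow> ?z s \<le> ?z x"
    using continuous_attains_sup[of "{0..T}" ?z] T_pos by auto
  have bd: "norm (V w s) \<le> ?z x * exp (\<mu> * s)" if "s \<in> {0..T}" for s
    using max[OF that] by (simp add: exp_minus field_simps)
  have "AE s in leb T. norm (w s) \<le> (m * ?z x) * exp (\<mu> * s) + f s"
    using le AE_space
  proof eventually_elim
    case (elim s)
    have "m * norm (V w s) \<le> m * (?z x * exp (\<mu> * s))"
      using bd[of s] elim \<open>m > 0\<close> by (intro mult_left_mono) auto
    then show ?case using elim by (simp add: mult.assoc)
  qed
  then have "norm (V w x) \<le> c * A + c * (m * ?z x) / \<mu> * exp (\<mu> * x)"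
    unfolding A_def using x \<mu> \<open>m > 0\<close> by (intro V_exp_bound w f) auto
  also have "c * (m * ?z x) / \<mu> * exp (\<mu> * x) = norm (V w x) / 2"
    using c_pos \<open>m > 0\<close> by (simp add: \<mu>_def exp_minus field_simps)
  finally have "norm (V w x) \<le> 2 * c * A" by simp
  then have "?z x \<le> 1 * (2 * c * A)"
    using x \<mu> by (intro mult_mono) auto
  then have "?z x * exp (\<mu> * t) \<le> (2 * c * A) * exp (\<mu> * T)"
    using t \<mu> c_pos A by (intro mult_mono[of "?z x"]) auto
  then show ?thesis
    using bd[of t] t by (simp add: A_def \<mu>_def algebra_simps)
qed

text \<open>The fixed point is sought for \<open>g = V w\<close>, which is continuous, and not for \<open>w\<close>; so the complete space
is that of bounded continuous functions. Putting \<open>g(t) = e\<^sup>\<mu>\<^sup>t \<phi>(t)\<close> and taking the plain sup norm of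
\<open>\<phi>\<close> amounts to the weighted norm of \<open>g\<close>.\<close>

lemma volterra_fixed_point:
  fixes \<Phi> :: "real \<Rightarrow> 'a::euclidean_space \<Rightarrow> 'a"
  assumes int: "\<And>g. continuous_on UNIV g \<Longrightarrow> integrable (leb T) (\<lambda>s. \<Phi> s (g s))"
    and "m > 0"
    and lip: "AE s in leb T. \<forall>x y. norm (\<Phi> s x - \<Phi> s y) \<le> m * norm (x - y)"
  shows "\<exists>g. continuous_on UNIV g \<and> (\<forall>t\<in>{0..T}. g t = V (\<lambda>s. \<Phi> s (g s)) t)"
proof -
  define \<mu> where "\<mu> = 2 * c * m"
  have \<mu>: "\<mu> > 0" using c_pos \<open>m > 0\<close> by (simp add: \<mu>_def)
  \<comment> \<open>The space consists of functions on the whole line, so the image under the operator is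
    extended by constants outside \<open>[0,T]\<close>.\<close>
  define p where "p t = max 0 (min T t)" for t
  have p: "p t \<in> {0..T}" for t using T_pos by (auto simp: p_def)
  have pt: "p t = t" if "t \<in> {0..T}" for t using that by (auto simp: p_def)
  have p_cont: "continuous_on UNIV p" unfolding p_def by (intro continuous_intros)
  define E where "E \<phi> s = exp (\<mu> * s) *\<^sub>R apply_bcontfun \<phi> s" for \<phi> :: "real \<Rightarrow>\<^sub>C 'a" and s
  have E_cont: "continuous_on UNIV (E \<phi>)" for \<phi>
    unfolding E_def by (intro continuous_intros) auto
  define G where "G \<phi> t = exp (- \<mu> * t) *\<^sub>R V (\<lambda>s. \<Phi> s (E \<phi> s)) t" for \<phi> t
  have G_cont: "continuous_on {0..T} (G \<phi>)" for \<phi>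
    unfolding G_def by (intro continuous_intros V_continuous int E_cont)
  have "(\<lambda>t. G \<phi> (p t)) \<in> bcontfun" for \<phi>
  proof -
    have "continuous_on UNIV (\<lambda>t. G \<phi> (p t))"
      by (intro continuous_on_compose2[OF G_cont p_cont]) (use p in auto)
    moreover have "bounded (G \<phi> ` {0..T})"
      by (intro compact_imp_bounded compact_continuous_image G_cont) auto
    then have "bounded (range (\<lambda>t. G \<phi> (p t)))"
      by (rule bounded_subset) (use p in auto)
    ultimately show ?thesis by (simp add: bcontfun_def)
  qed
  then have app: "apply_bcontfun (Bcontfun (\<lambda>t. G \<phi> (p t))) = (\<lambda>t. G \<phi> (p t))" for \<phi>
    by (rule Bcontfun_inverse)
  have "dist (Bcontfun (\<lambda>t. G \<phi> (p t))) (Bcontfun (\<lambda>t. G \<psi> (p t))) \<le> 1/2 * dist \<phi> \<psi>" for \<phi> \<psi>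
  proof (rule dist_bound)
    fix t
    let ?w = "\<lambda>\<phi> s. \<Phi> s (E \<phi> s)"
    have AE: "AE s in leb T. norm (?w \<phi> s - ?w \<psi> s) \<le> (m * dist \<phi> \<psi>) * exp (\<mu> * s) + 0"
      using lip
    proof eventually_elim
      case (elim s)
      have "norm (?w \<phi> s - ?w \<psi> s) \<le> m * norm (E \<phi> s - E \<psi> s)" using elim by blast
      also have "norm (E \<phi> s - E \<psi> s) = exp (\<mu> * s) * dist (apply_bcontfun \<phi> s) (apply_bcontfun \<psi> s)"
        unfolding E_def by (simp add: dist_norm flip: scaleR_right_diff_distrib)
      also have "\<dots> \<le> exp (\<mu> * s) * dist \<phi> \<psi>"
        by (intro mult_left_mono dist_bounded) auto
      finally show ?case using \<open>m > 0\<close> by (simp add: mult_ac)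
    qed
    have "norm (V (\<lambda>s. ?w \<phi> s - ?w \<psi> s) (p t))
        \<le> c * (LINT s|leb T. 0) + c * (m * dist \<phi> \<psi>) / \<mu> * exp (\<mu> * p t)"
      using p[of t] \<mu> \<open>m > 0\<close>
      by (intro V_exp_bound[OF _ _ _ _ _ _ _ AE] Bochner_Integration.integrable_diff int E_cont) auto
    then have "norm (V (?w \<phi>) (p t) - V (?w \<psi>) (p t)) \<le> exp (\<mu> * p t) * (dist \<phi> \<psi> / 2)"
      using p[of t] c_pos \<open>m > 0\<close>
      by (subst (asm) V_diff) (auto intro!: int E_cont simp: \<mu>_def field_simps)
    then have "exp (- \<mu> * p t) * norm (V (?w \<phi>) (p t) - V (?w \<psi>) (p t)) \<le> dist \<phi> \<psi> / 2"
      by (simp add: exp_minus field_simps)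
    then show "dist (apply_bcontfun (Bcontfun (\<lambda>t. G \<phi> (p t))) t)
        (apply_bcontfun (Bcontfun (\<lambda>t. G \<psi> (p t))) t) \<le> 1/2 * dist \<phi> \<psi>"
      unfolding app unfolding G_def dist_norm[of "_ *\<^sub>R _"] by (simp flip: scaleR_right_diff_distrib)
  qed
  then have "\<exists>!\<phi>. Bcontfun (\<lambda>t. G \<phi> (p t)) = \<phi>"
    by (intro banach_fix_type[of "1/2"] allI) (simp_all del: mult.commute)
  then obtain \<phi> where \<phi>: "Bcontfun (\<lambda>t. G \<phi> (p t)) = \<phi>"
    by (elim ex1E)
  show ?thesis
  proof (intro exI[of _ "E \<phi>"] conjI ballI E_cont)
    fix t assume t: "t \<in> {0..T}"
    have "apply_bcontfun \<phi> t = G \<phi> t" using fun_cong[OF app[of \<phi>], of t] by (simp only: \<phi> pt[OF t])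
    then have "E \<phi> t = exp (\<mu> * t) *\<^sub>R G \<phi> t" by (simp add: E_def)
    also have "\<dots> = V (\<lambda>s. \<Phi> s (E \<phi> s)) t" unfolding G_def by (simp flip: exp_add)
    finally show "E \<phi> t = V (\<lambda>s. \<Phi> s (E \<phi> s)) t" .
  qed
qed

end

section \<open>Functions determined by their integrals\<close>

text \<open>The half-lines \<open>(-\<infinity>,x)\<close> generate the Borel sets and are stable under intersection, so all integrals
over Borel sets vanish by Dynkin's theorem; a Lebesgue set is a Borel set up to a null set. The
function is extended by zero to the line, because a Borel set need not lie in \<open>(0,T)\<close>.\<close>

lemma AE_zero_if_initial_integrals_zero:
  fixes d :: "real \<Rightarrow> real"
  assumes "T > 0" and d: "integrable (leb T) d"
    and zero: "\<And>x. 0 < x \<Longrightarrow> x \<le> T \<Longrightarrow> (LINT s|leb T. indicator {..<x} s * d s) = 0"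
  shows "AE s in leb T. d s = 0"
proof -
  interpret finite_measure "leb T" by (rule finite_measure_leb)
  define f where "f s = indicator {0<..<T} s * d s" for s
  have f: "integrable lebesgue f"
    using d by (simp add: integrable_restrict_space f_def[abs_def])
  have f_set: "set_integrable lebesgue B f" if "B \<in> sets lebesgue" for B
    unfolding set_integrable_def using f that by (intro integrable_mult_indicator) auto
  have "range (\<lambda>a. {x. eucl_less x a}) = range (lessThan :: real \<Rightarrow> real set)"
    by (auto simp: eucl_less_def image_iff lessThan_def)
  then have gen: "sets borel = sigma_sets UNIV (range (lessThan :: real \<Rightarrow> real set))"
    by (simp add: borel_eq_lessThan)
  have stable: "Int_stable (range lessThan :: real set set)"
  proof (rule Int_stableI_image)
    show "\<exists>z\<in>UNIV. {..<x} \<inter> {..<y} = {..<z}" for x y :: real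
      by (intro bexI[of _ "min x y"]) auto
  qed
  have pow: "range lessThan \<subseteq> Pow (UNIV :: real set)" by simp
  have borel0: "(LINT s:B|lebesgue. f s) = 0" if "B \<in> sets borel" for B
    using stable pow that[unfolded gen]
  proof (induction rule: sigma_sets_induct_disjoint)
    case (basic A)
    then obtain x where A: "A = {..<x}" by auto
    show ?case
    proof (cases "x \<le> 0")
      case True
      then have "(\<lambda>s. indicator A s *\<^sub>R f s) = (\<lambda>s. 0)"
        by (auto simp: A f_def indicator_def)
      then show ?thesis by (simp add: set_lebesgue_integral_def)
    next
      case False
      have "(LINT s:A|lebesgue. f s) = (LINT s|leb T. indicator {..<min x T} s * d s)"
        unfolding set_lebesgue_integral_def f_def A
        by (subst integral_restrict_space) (auto simp: indicator_def intro!: Bochner_Integration.integral_cong)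
      then show ?thesis using zero[of "min x T"] False \<open>T > 0\<close> by simp
    qed
  next
    case empty
    show ?case by (simp add: set_lebesgue_integral_def)
  next
    case (compl A)
    have A: "A \<in> sets lebesgue"
      using compl(1) unfolding gen[symmetric] by simp
    have "(LINT s:UNIV|lebesgue. f s) = (LINT s|leb T. indicator {..<T} s * d s)"
      unfolding set_lebesgue_integral_def f_def
      by (subst integral_restrict_space) (auto simp: indicator_def intro!: Bochner_Integration.integral_cong)
    also have "\<dots> = 0" using zero[of T] \<open>T > 0\<close> by simp
    finally have "(LINT s:A \<union> (UNIV - A)|lebesgue. f s) = 0" by simp
    moreover have "(LINT s:A \<union> (UNIV - A)|lebesgue. f s)
        = (LINT s:A|lebesgue. f s) + (LINT s:UNIV - A|lebesgue. f s)"
      by (intro set_integral_Un f_set sets.Diff) (use A in auto)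
    ultimately show ?case using compl by simp
  next
    case (union A)
    have A: "A i \<in> sets lebesgue" for i
      using union(2) unfolding gen[symmetric] by auto
    have "(LINT s:(\<Union>i. A i)|lebesgue. f s) = (\<Sum>i. LINT s:A i|lebesgue. f s)"
      by (rule lebesgue_integral_countable_add)
         (use A f_set union(1) in \<open>auto simp: disjoint_family_on_def\<close>)
    then show ?case using union by simp
  qed
  show ?thesis
  proof (rule density_zero[OF d])
    fix A assume "A \<in> sets (leb T)"
    then have A: "A \<in> sets lebesgue" "A \<subseteq> {0<..<T}"
      by (auto simp: sets_restrict_space)
    obtain C N where C: "fsigma C" "N \<in> null_sets lebesgue" "C \<union> N = A" "disjnt C N"
      using lebesgue_set_almost_fsigma[OF A(1)] by metis
    have CN: "C \<in> sets borel" "N \<in> null_sets lebesgue"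
      using C by (auto elim!: fsigma.cases)
    have C_leb: "C \<in> sets lebesgue" using CN(1) by simp
    have meas: "(\<lambda>s. indicator B s *\<^sub>R f s) \<in> borel_measurable lebesgue" if "B \<in> sets lebesgue" for B
      using f_set[OF that] unfolding set_integrable_def by (rule borel_measurable_integrable)
    have "(LINT s:A|lebesgue. f s) = (LINT s:C|lebesgue. f s)"
      unfolding set_lebesgue_integral_def
    proof (rule integral_cong_AE)
      show "AE s in lebesgue. indicator A s *\<^sub>R f s = indicator C s *\<^sub>R f s"
        using AE_not_in[OF CN(2)] by eventually_elim (auto simp: indicator_def C(3)[symmetric])
    qed (rule meas[OF A(1)], rule meas[OF C_leb])
    moreover have "(LINT s:A|leb T. d s) = (LINT s:A|lebesgue. f s)"
      unfolding set_lebesgue_integral_def f_def using A(2)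
      by (subst integral_restrict_space) (auto simp: indicator_def intro!: Bochner_Integration.integral_cong)
    ultimately show "(LINT s:A|leb T. d s) = 0" using borel0[OF CN(1)] by simp
  qed
qed

section \<open>Injectivity of the fractional integral\<close>

text \<open>The truncated power \<open>r\<^sub>+\<^sup>p\<close>. It is \<open>0\<close> for \<open>r \<le> 0\<close> even when \<open>p = 0\<close>, since \<open>0 powr 0 = 0\<close>.\<close>

definition tpow :: "real \<Rightarrow> real \<Rightarrow> real" where
  "tpow p r = max r 0 powr p"

lemma tpow_measurable [measurable]: "tpow p \<in> borel_measurable borel"
  unfolding tpow_def by measurable

lemma tpow_nonneg [simp]: "0 \<le> tpow p r"
  by (simp add: tpow_def)

lemma tpow_eq_0: "r \<le> 0 \<Longrightarrow> tpow p r = 0"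
  by (simp add: tpow_def max_absorb2)

lemma tpow_le: "p \<ge> 0 \<Longrightarrow> r \<le> T \<Longrightarrow> T > 0 \<Longrightarrow> tpow p r \<le> T powr p"
  by (auto simp: tpow_def intro!: powr_mono2)

lemma measurable_leb: "f \<in> borel_measurable borel \<Longrightarrow> f \<in> borel_measurable (leb T)"
  by (intro measurable_restrict_space1 measurable_completion) simp

text \<open>The substitution \<open>t = s + L \<tau>\<close> with \<open>L = x - s\<close> maps this to the Beta integral over \<open>[0,1]\<close>. Nonnegative
exponents keep the integrand bounded.\<close>

lemma integral_tpow_conv:
  assumes p: "p \<ge> 0" "q \<ge> 0" and s: "0 \<le> s" and x: "x \<le> T" and "T > 0"
  shows "(LINT t|leb T. tpow q (x - t) * tpow p (t - s)) = Beta (p + 1) (q + 1) * tpow (p + q + 1) (x - s)"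
proof (cases "s < x")
  case False
  have "(\<lambda>t. tpow q (x - t) * tpow p (t - s)) = (\<lambda>t. 0)"
    using False tpow_eq_0 by (auto simp: fun_eq_iff) (metis diff_le_0_iff_le le_cases order_trans not_le)
  then show ?thesis using False by (simp add: tpow_eq_0)
next
  case True
  define L where "L = x - s"
  have L: "L > 0" and x_eq: "x = s + L" using True by (auto simp: L_def)
  have "((\<lambda>t. t powr p * (1 - t) powr q) has_integral Beta (p + 1) (q + 1)) (cbox 0 1)"
    using has_integral_Beta_real[of "p + 1" "q + 1"] p by simp
  moreover have "(0 - - s / L) /\<^sub>R (1 / L) = s" "(1 - - s / L) /\<^sub>R (1 / L) = x"
    using L by (simp_all add: L_def distrib_left)
  ultimately have "((\<lambda>t. (t / L - s / L) powr p * (1 - (t / L - s / L)) powr q) has_integral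
      L * Beta (p + 1) (q + 1)) {s..x}"
    using has_integral_affinity'[of "\<lambda>t. t powr p * (1 - t) powr q" _ 0 1 "1/L" "- s/L"] L
    by simp
  then have "((\<lambda>t. L powr (p + q) * ((t / L - s / L) powr p * (1 - (t / L - s / L)) powr q)) has_integral
      L powr (p + q) * (L * Beta (p + 1) (q + 1))) {s..x}"
    by (rule has_integral_mult_right)
  then have "((\<lambda>t. tpow q (x - t) * tpow p (t - s)) has_integral
      L powr (p + q) * (L * Beta (p + 1) (q + 1))) {s..x}"
  proof (rule has_integral_eq[rotated])
    fix t assume t: "t \<in> {s..x}"
    have "t / L - s / L = (t - s) / L" "1 - (t / L - s / L) = (x - t) / L"
      using L x_eq by (simp_all add: field_simps)
    then show "L powr (p + q) * ((t / L - s / L) powr p * (1 - (t / L - s / L)) powr q)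
        = tpow q (x - t) * tpow p (t - s)"
      using t L by (simp add: tpow_def powr_divide powr_add)
  qed
  then have "((\<lambda>t. tpow q (x - t) * tpow p (t - s)) has_integral
      L powr (p + q) * (L * Beta (p + 1) (q + 1))) {s<..<x}"
    by (simp add: has_integral_Icc_iff_Ioo)
  then have "((\<lambda>t. tpow q (x - t) * tpow p (t - s)) has_integral
      L powr (p + q) * (L * Beta (p + 1) (q + 1))) {0<..<T}"
    by (rule has_integral_on_superset) (use s x in \<open>auto simp: tpow_eq_0\<close>)
  moreover have "integrable (leb T) (\<lambda>t. tpow q (x - t) * tpow p (t - s))"
  proof (rule Bochner_Integration.integrable_bound[OF integrable_leb_const[of T "T powr q * T powr p"]])
    show "AE t in leb T. norm (tpow q (x - t) * tpow p (t - s)) \<le> norm (T powr q * T powr p)"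
      using assms by (intro AE_I2) (auto simp: abs_mult intro!: mult_mono tpow_le)
  qed (intro measurable_leb; measurable)
  then have "((\<lambda>t. tpow q (x - t) * tpow p (t - s)) has_integral
      (LINT t|leb T. tpow q (x - t) * tpow p (t - s))) {0<..<T}"
    by (intro has_integral_integral_lebesgue_on) auto
  ultimately have "(LINT t|leb T. tpow q (x - t) * tpow p (t - s)) = L powr (p + q) * (L * Beta (p + 1) (q + 1))"
    by (rule has_integral_unique[symmetric])
  then show ?thesis using L by (simp add: tpow_def L_def powr_add)
qed

text \<open>The semigroup law of fractional integration, up to normalization: exchange the order of
integration and use the Beta integral for the inner one.\<close>

lemma tpow_semigroup:
  assumes p: "p \<ge> 0" "q \<ge> 0" and x: "x \<le> T" and "T > 0" and d: "integrable (leb T) d"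
  shows "(LINT t|leb T. tpow q (x - t) * (LINT s|leb T. tpow p (t - s) * d s))
       = Beta (p + 1) (q + 1) * (LINT s|leb T. tpow (p + q + 1) (x - s) * d s)"
proof -
  interpret finite_measure "leb T" by (rule finite_measure_leb)
  interpret P: pair_sigma_finite "leb T" "leb T" ..
  let ?f = "\<lambda>(t, s). tpow q (x - t) * (tpow p (t - s) * d s)"
  have id: "(\<lambda>t. t) \<in> borel_measurable (leb T)" by (intro measurable_leb) simp
  have [measurable]: "fst \<in> borel_measurable (leb T \<Otimes>\<^sub>M leb T)" "snd \<in> borel_measurable (leb T \<Otimes>\<^sub>M leb T)"
    "(\<lambda>z. d (snd z)) \<in> borel_measurable (leb T \<Otimes>\<^sub>M leb T)"
    using measurable_compose[OF measurable_fst id] measurable_compose[OF measurable_snd id]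
      measurable_compose[OF measurable_snd borel_measurable_integrable[OF d]] by auto
  have meas: "?f \<in> borel_measurable (leb T \<Otimes>\<^sub>M leb T)"
    unfolding split_beta' by measurable
  have "integrable (leb T \<Otimes>\<^sub>M leb T) (\<lambda>(t, s). d s)"
    by (rule P.Fubini_integrable) (use d integrable_leb_const in \<open>auto simp: split_beta'\<close>)
  then have "integrable (leb T \<Otimes>\<^sub>M leb T) (\<lambda>z. T powr q * (T powr p * d (snd z)))"
    by (simp add: split_beta')
  then have int: "integrable (leb T \<Otimes>\<^sub>M leb T) ?f"
  proof (rule Bochner_Integration.integrable_bound[OF _ meas])
    show "AE z in leb T \<Otimes>\<^sub>M leb T. norm (?f z) \<le> norm (T powr q * (T powr p * d (snd z)))"
      using assms by (intro AE_I2)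
        (auto simp: space_pair_measure abs_mult intro!: mult_mono tpow_le)
  qed
  have "(LINT t|leb T. tpow q (x - t) * (LINT s|leb T. tpow p (t - s) * d s))
      = (LINT t|leb T. LINT s|leb T. tpow q (x - t) * (tpow p (t - s) * d s))"
    by simp
  also have "\<dots> = (LINT s|leb T. LINT t|leb T. tpow q (x - t) * (tpow p (t - s) * d s))"
    by (rule P.Fubini_integral[OF int, symmetric])
  also have "\<dots> = (LINT s|leb T. Beta (p + 1) (q + 1) * (tpow (p + q + 1) (x - s) * d s))"
  proof (rule Bochner_Integration.integral_cong[OF refl])
    fix s assume "s \<in> space (leb T)"
    then have "(LINT t|leb T. (tpow q (x - t) * tpow p (t - s)) * d s)
        = Beta (p + 1) (q + 1) * tpow (p + q + 1) (x - s) * d s"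
      using integral_tpow_conv[OF p _ x \<open>T > 0\<close>, of s] by simp
    then show "(LINT t|leb T. tpow q (x - t) * (tpow p (t - s) * d s))
        = Beta (p + 1) (q + 1) * (tpow (p + q + 1) (x - s) * d s)"
      by (simp add: mult.assoc)
  qed
  finally show ?thesis by simp
qed

lemma integrable_tpow:
  assumes "p \<ge> 0" "x \<le> T" "T > 0" and d: "integrable (leb T) d"
  shows "integrable (leb T) (\<lambda>s. tpow p (x - s) * d s)"
proof (rule Bochner_Integration.integrable_bound)
  show "integrable (leb T) (\<lambda>s. T powr p * d s)" using d by simp
  show "AE s in leb T. norm (tpow p (x - s) * d s) \<le> norm (T powr p * d s)"
    using assms by (intro AE_I2) (auto simp: abs_mult intro!: mult_mono tpow_le)
  have "(\<lambda>s. tpow p (x - s)) \<in> borel_measurable (leb T)" by (intro measurable_leb) measurable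
  then show "(\<lambda>s. tpow p (x - s) * d s) \<in> borel_measurable (leb T)"
    using d by (intro borel_measurable_times) auto
qed

text \<open>The second difference of \<open>r\<^sub>+\<^sup>2\<close> is \<open>2 h\<^sup>2\<close> where all three nodes are positive, is \<open>0\<close> where none is, and
is of order \<open>h\<^sup>2\<close> in between. This supplies the dominating function for the limit \<open>h \<rightarrow> 0\<close>.\<close>

lemma second_difference_tpow_bound:
  assumes "h > 0"
  shows "\<bar>tpow 2 y - 2 * tpow 2 (y - h) + tpow 2 (y - 2 * h)\<bar> \<le> 6 * h\<^sup>2"
proof -
  have sq: "tpow 2 r = (if r > 0 then r\<^sup>2 else 0)" for r by (simp add: tpow_def max_def)
  consider "y \<le> 0" | "2 * h \<le> y" | "0 < y" "y < 2 * h" by linarith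
  then show ?thesis
  proof cases
    case 1 then show ?thesis using assms by (simp add: sq)
  next
    case 2
    then have "tpow 2 y - 2 * tpow 2 (y - h) + tpow 2 (y - 2 * h) = 2 * h\<^sup>2"
      using assms by (auto simp: sq power2_eq_square algebra_simps)
    then show ?thesis by simp
  next
    case 3
    have "(y - h)\<^sup>2 \<le> h\<^sup>2" if "y - h > 0"
      using 3 that by (intro power_mono) auto
    moreover have "y\<^sup>2 \<le> (2 * h)\<^sup>2"
      using 3 by (intro power_mono) auto
    ultimately have "tpow 2 y \<le> (2 * h)\<^sup>2" "tpow 2 (y - h) \<le> h\<^sup>2" "tpow 2 (y - 2 * h) = 0"
      using 3 assms by (auto simp: sq simp del: power_mult_distrib)
    moreover have "0 \<le> tpow 2 y" "0 \<le> tpow 2 (y - h)" by simp_all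
    moreover have "(2 * h)\<^sup>2 = 4 * h\<^sup>2" by simp
    ultimately show ?thesis by linarith
  qed
qed

text \<open>Backward second difference quotients in \<open>x\<close> of \<open>(x - s)\<^sub>+\<^sup>2\<close> converge boundedly to twice the indicator
of \<open>s < x\<close>. This passes from the squared kernel to the integral of \<open>d\<close> over \<open>(0,x)\<close> in a single
limit. Backward differences keep the nodes in \<open>(-\<infinity>,T]\<close> also for \<open>x = T\<close>.\<close>

lemma AE_zero_if_tpow2_zero:
  assumes "T > 0" and d: "integrable (leb T) d"
    and zero: "\<And>x. 0 < x \<Longrightarrow> x \<le> T \<Longrightarrow> (LINT s|leb T. tpow 2 (x - s) * d s) = 0"
  shows "AE s in leb T. d s = 0"
proof (rule AE_zero_if_initial_integrals_zero[OF \<open>T > 0\<close> d])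
  fix x assume x: "0 < x" "x \<le> T"
  have zero': "(LINT s|leb T. tpow 2 (y - s) * d s) = 0" if "y \<le> T" for y
  proof (cases "y > 0")
    case False
    then have "(LINT s|leb T. tpow 2 (y - s) * d s) = (LINT s|leb T. 0)"
      by (intro Bochner_Integration.integral_cong) (auto simp: tpow_eq_0)
    then show ?thesis by simp
  qed (use zero that in auto)
  define h where "h n = 1 / real (Suc n)" for n
  have h: "h n > 0" for n by (simp add: h_def)
  have h0: "h \<longlonglongrightarrow> 0" unfolding h_def by (rule lim_1_over_n[THEN LIMSEQ_Suc])
  define D where "D n s = (tpow 2 (x - s) - 2 * tpow 2 (x - h n - s) + tpow 2 (x - 2 * h n - s)) / (h n)\<^sup>2" for n s
  have D_eq: "D n s * d s = (tpow 2 (x - s) * d s - 2 * (tpow 2 (x - h n - s) * d s)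
      + tpow 2 (x - 2 * h n - s) * d s) / (h n)\<^sup>2" for n s
    by (simp add: D_def algebra_simps)
  have int: "integrable (leb T) (\<lambda>s. tpow 2 (y - s) * d s)" if "y \<le> T" for y
    using that d \<open>T > 0\<close> by (intro integrable_tpow) auto
  have le: "x - h n \<le> T" "x - 2 * h n \<le> T" for n using x h[of n] by auto
  have D0: "(LINT s|leb T. D n s * d s) = 0" for n
    unfolding D_eq using int[OF x(2)] int[OF le(1)] int[OF le(2)] zero'[OF x(2)] zero'[OF le(1)] zero'[OF le(2)]
    by simp
  have Dint: "integrable (leb T) (\<lambda>s. D n s * d s)" for n
    unfolding D_eq using int[OF x(2)] int[OF le(1)] int[OF le(2)] by simp
  have "(\<lambda>n. LINT s|leb T. D n s * d s) \<longlonglongrightarrow> (LINT s|leb T. 2 * (indicator {..<x} s * d s))"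
  proof (rule integral_dominated_convergence[where w = "\<lambda>s. 6 * \<bar>d s\<bar>"])
    show "AE s in leb T. (\<lambda>n. D n s * d s) \<longlonglongrightarrow> 2 * (indicator {..<x} s * d s)"
    proof (rule AE_I2)
      fix s
      have "(\<lambda>n. D n s) \<longlonglongrightarrow> 2 * indicator {..<x} s"
      proof (cases "s < x")
        case True
        have "eventually (\<lambda>n. h n < (x - s) / 2) sequentially"
          using order_tendstoD(2)[OF h0, of "(x - s) / 2"] True by simp
        then have "eventually (\<lambda>n. D n s = 2 * indicator {..<x} s) sequentially"
        proof eventually_elim
          case (elim n)
          have "D n s = ((x - s)\<^sup>2 - 2 * (x - h n - s)\<^sup>2 + (x - 2 * h n - s)\<^sup>2) / (h n)\<^sup>2"
            using elim h[of n] by (simp add: D_def tpow_def)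
          also have "(x - s)\<^sup>2 - 2 * (x - h n - s)\<^sup>2 + (x - 2 * h n - s)\<^sup>2 = 2 * (h n)\<^sup>2"
            by (simp add: power2_eq_square algebra_simps)
          finally show ?case using h[of n] True by simp
        qed
        then show ?thesis by (rule tendsto_eventually)
      next
        case False
        then have "D n s = 0" for n using h[of n] by (simp add: D_def tpow_eq_0)
        then show ?thesis using False by simp
      qed
      then show "(\<lambda>n. D n s * d s) \<longlonglongrightarrow> 2 * (indicator {..<x} s * d s)"
        unfolding mult.assoc[symmetric] by (intro tendsto_mult tendsto_const)
    qed
    show "AE s in leb T. norm (D n s * d s) \<le> 6 * \<bar>d s\<bar>" for n
    proof (rule AE_I2)
      fix s
      have "\<bar>D n s\<bar> \<le> 6"
        using second_difference_tpow_bound[OF h[of n], of "x - s"] h[of n]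
        by (simp add: D_def divide_le_eq diff_diff_eq add.commute)
      then show "norm (D n s * d s) \<le> 6 * \<bar>d s\<bar>"
        by (simp add: abs_mult mult_right_mono)
    qed
    have "indicator {..<x} \<in> borel_measurable (leb T)" by (intro measurable_leb) simp
    then show "(\<lambda>s. 2 * (indicator {..<x} s * d s)) \<in> borel_measurable (leb T)"
      using d by (intro borel_measurable_times) auto
  qed (use d Dint in auto)
  then have "(LINT s|leb T. 2 * (indicator {..<x} s * d s)) = 0"
    unfolding D0 by (simp add: LIMSEQ_const_iff)
  then show "(LINT s|leb T. indicator {..<x} s * d s) = 0" by simp
qed

lemma J_eq_tpow:
  assumes "t \<le> T"
  shows "J \<gamma> w t = (LINT s|leb T. tpow (\<gamma> - 1) (t - s) / Gamma \<gamma> * w s)"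
proof -
  have "(LINT s|lebesgue_on {0<..<t}. (t - s) powr (\<gamma> - 1) * w s)
      = (LINT s|leb T. tpow (\<gamma> - 1) (t - s) * w s)"
    using assms by (subst (1 2) integral_restrict_space)
      (auto simp: indicator_def tpow_def max_def intro!: Bochner_Integration.integral_cong)
  then show ?thesis by (simp add: J_def)
qed

lemma L2_integrable:
  assumes "w \<in> L2 T"
  shows "integrable (leb T) w"
proof (rule Bochner_Integration.integrable_bound)
  show "integrable (leb T) (\<lambda>t. 1 + (w t)\<^sup>2)"
    using assms integrable_leb_const[of T "1 :: real"] by (intro Bochner_Integration.integrable_add) (auto simp: L2_def)
  show "AE t in leb T. norm (w t) \<le> norm (1 + (w t)\<^sup>2)"
  proof (rule AE_I2)
    fix t
    have "2 * \<bar>w t\<bar> \<le> 1 + (w t)\<^sup>2"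
      using sum_squares_bound[of 1 "\<bar>w t\<bar>"] by (simp add: mult_ac)
    then show "norm (w t) \<le> norm (1 + (w t)\<^sup>2)" by (simp add: add_nonneg_nonneg)
  qed
qed (use assms in \<open>simp add: L2_def\<close>)

text \<open>Convolution of \<open>J \<gamma> d = 0\<close> with the power of exponent \<open>2 - \<gamma>\<close> produces the squared kernel. With
\<open>1 \<le> \<gamma> \<le> 2\<close> the exponents \<open>\<gamma> - 1\<close> and \<open>2 - \<gamma>\<close> are both nonnegative, so all kernels stay bounded.\<close>

lemma J_inj:
  assumes "T > 0" "1 \<le> \<gamma>" "\<gamma> \<le> 2" and w: "integrable (leb T) w" "integrable (leb T) w'"
    and eq: "AE t in leb T. J \<gamma> w t = J \<gamma> w' t"
  shows "AE t in leb T. w t = w' t"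
proof -
  define d where "d s = w s - w' s" for s
  have d: "integrable (leb T) d" unfolding d_def using w by simp
  have G: "Gamma \<gamma> > 0" using assms by (intro Gamma_real_pos) auto
  have zero: "AE t in leb T. (LINT s|leb T. tpow (\<gamma> - 1) (t - s) * d s) = 0"
    using eq AE_space
  proof eventually_elim
    case (elim t)
    then have t: "t \<le> T" by simp
    have "(LINT s|leb T. tpow (\<gamma> - 1) (t - s) * d s)
        = (LINT s|leb T. tpow (\<gamma> - 1) (t - s) * w s) - (LINT s|leb T. tpow (\<gamma> - 1) (t - s) * w' s)"
      unfolding d_def right_diff_distrib using assms t
      by (intro Bochner_Integration.integral_diff integrable_tpow) auto
    also have "\<dots> = Gamma \<gamma> * (J \<gamma> w t - J \<gamma> w' t)"
      using G by (simp add: J_eq_tpow[OF t] algebra_simps)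
    finally show ?case using elim by simp
  qed
  have "AE s in leb T. d s = 0"
  proof (rule AE_zero_if_tpow2_zero[OF \<open>T > 0\<close> d])
    fix x assume x: "0 < x" "x \<le> T"
    let ?p = "\<gamma> - 1" and ?q = "2 - \<gamma>"
    have "(LINT t|leb T. tpow ?q (x - t) * (LINT s|leb T. tpow ?p (t - s) * d s)) = 0"
      using zero by (intro integral_eq_zero_AE) auto
    moreover have "Beta (?p + 1) (?q + 1) > 0"
      using assms by (simp add: Beta_def Gamma_real_pos)
    moreover have "(LINT t|leb T. tpow ?q (x - t) * (LINT s|leb T. tpow ?p (t - s) * d s))
        = Beta (?p + 1) (?q + 1) * (LINT s|leb T. tpow (?p + ?q + 1) (x - s) * d s)"
      using assms x d by (intro tpow_semigroup) auto
    ultimately show "(LINT s|leb T. tpow 2 (x - s) * d s) = 0" by simp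
  qed
  then show ?thesis by (simp add: d_def)
qed

section \<open>The function spaces\<close>

lemma L2_add:
  assumes "f \<in> L2 T" "g \<in> L2 T"
  shows "(\<lambda>t. f t + g t) \<in> L2 T"
proof -
  have "integrable (leb T) (\<lambda>t. (f t + g t)\<^sup>2)"
  proof (rule Bochner_Integration.integrable_bound)
    show "integrable (leb T) (\<lambda>t. 2 * (f t)\<^sup>2 + 2 * (g t)\<^sup>2)"
      using assms by (simp add: L2_def)
    have "(a + b)\<^sup>2 \<le> 2 * a\<^sup>2 + 2 * b\<^sup>2" for a b :: real
      using sum_squares_bound[of a b] by (simp add: power2_sum)
    then show "AE t in leb T. norm ((f t + g t)\<^sup>2) \<le> norm (2 * (f t)\<^sup>2 + 2 * (g t)\<^sup>2)"
      by (simp add: add_nonneg_nonneg)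
  qed (use assms in \<open>auto simp: L2_def intro!: borel_measurable_power borel_measurable_add\<close>)
  then show ?thesis using assms by (auto simp: L2_def intro: borel_measurable_add)
qed

lemma L2_zero: "(\<lambda>t. 0) \<in> L2 T"
  by (simp add: L2_def)

lemma L2_sum:
  assumes "finite I" "\<And>i. i \<in> I \<Longrightarrow> f i \<in> L2 T"
  shows "(\<lambda>t. \<Sum>i\<in>I. f i t) \<in> L2 T"
  using assms by (induction I rule: finite_induct) (auto intro!: L2_zero L2_add)

lemma L2_bounded_mult:
  assumes f: "f \<in> borel_measurable (leb T)" "AE t in leb T. \<bar>f t\<bar> \<le> M" and g: "g \<in> L2 T"
  shows "(\<lambda>t. f t * g t) \<in> L2 T"
proof -
  have "integrable (leb T) (\<lambda>t. (f t * g t)\<^sup>2)"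
  proof (rule Bochner_Integration.integrable_bound)
    show "integrable (leb T) (\<lambda>t. M\<^sup>2 * (g t)\<^sup>2)" using g by (simp add: L2_def)
    show "AE t in leb T. norm ((f t * g t)\<^sup>2) \<le> norm (M\<^sup>2 * (g t)\<^sup>2)"
      using f(2)
    proof eventually_elim
      case (elim t)
      then have "(f t)\<^sup>2 \<le> M\<^sup>2" by (rule power2_le_iff_abs_le[THEN iffD2, rotated]) (use elim in linarith)
      then show ?case by (simp add: power_mult_distrib mult_right_mono)
    qed
  qed (use f g in \<open>auto simp: L2_def intro!: borel_measurable_power borel_measurable_times\<close>)
  then show ?thesis using f g by (auto simp: L2_def intro: borel_measurable_times)
qed

lemma L2_continuous:
  fixes f :: "real \<Rightarrow> real"
  assumes "continuous_on {0..T} f"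
  shows "f \<in> L2 T"
proof -
  have "continuous_on {0<..<T} f" by (rule continuous_on_subset[OF assms]) auto
  then have m: "f \<in> borel_measurable (leb T)"
    by (rule continuous_imp_measurable_on_sets_lebesgue) auto
  have "bounded (f ` {0..T})"
    by (intro compact_imp_bounded compact_continuous_image assms) auto
  then obtain B where B: "\<And>t. t \<in> {0..T} \<Longrightarrow> \<bar>f t\<bar> \<le> B"
    unfolding bounded_iff by (metis imageI real_norm_def)
  have "integrable (leb T) (\<lambda>t. (f t)\<^sup>2)"
  proof (rule Bochner_Integration.integrable_bound[OF integrable_leb_const])
    show "AE t in leb T. norm ((f t)\<^sup>2) \<le> norm (B\<^sup>2)"
    proof (rule AE_I2)
      fix t assume "t \<in> space (leb T)"
      then have "\<bar>f t\<bar>\<^sup>2 \<le> B\<^sup>2" using B[of t] by (intro power_mono) auto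
      then show "norm ((f t)\<^sup>2) \<le> norm (B\<^sup>2)" by simp
    qed
  qed (use m in simp)
  with m show ?thesis by (simp add: L2_def)
qed

lemma vec_eq_sum_axis: "(x :: real^'n) = (\<Sum>i\<in>UNIV. x $ i *\<^sub>R axis i 1)"
  using basis_expansion[of x] by (simp add: scalar_mult_eq_scaleR)

lemma L2_vec_integrable:
  fixes w :: "real \<Rightarrow> real^'n"
  assumes "w \<in> L2_vec T"
  shows "integrable (leb T) w"
proof -
  have "integrable (leb T) (\<lambda>t. \<Sum>i\<in>UNIV. w t $ i *\<^sub>R (axis i 1 :: real^'n))"
    using assms by (intro Bochner_Integration.integrable_sum integrable_scaleR_left L2_integrable)
      (auto simp: L2_vec_def)
  then show ?thesis by (simp flip: vec_eq_sum_axis)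
qed

lemma L2_vec_add:
  "f \<in> L2_vec T \<Longrightarrow> g \<in> L2_vec T \<Longrightarrow> (\<lambda>t. f t + g t) \<in> L2_vec T"
  by (auto simp: L2_vec_def intro: L2_add)

lemma L2_vec_continuous:
  "continuous_on {0..T} f \<Longrightarrow> f \<in> L2_vec T"
  by (auto simp: L2_vec_def intro!: L2_continuous continuous_intros)

lemma L2_vec_sq_integrable:
  assumes "F \<in> L2_vec T"
  shows "integrable (leb T) (\<lambda>t. (norm (F t))\<^sup>2)"
    and "(L2_vec_norm T F)\<^sup>2 = (LINT t|leb T. (norm (F t))\<^sup>2)"
proof -
  have sq: "(norm x)\<^sup>2 = (\<Sum>i\<in>UNIV. (x $ i)\<^sup>2)" for x :: "real^'a"
    by (simp add: norm_vec_def L2_set_def sum_nonneg)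
  have int: "integrable (leb T) (\<lambda>t. (F t $ i)\<^sup>2)" for i
    using assms by (auto simp: L2_vec_def L2_def)
  then show "integrable (leb T) (\<lambda>t. (norm (F t))\<^sup>2)" by (simp add: sq)
  show "(L2_vec_norm T F)\<^sup>2 = (LINT t|leb T. (norm (F t))\<^sup>2)"
    using int by (simp add: sq L2_vec_norm_def L2_set_def L2_norm_def sum_nonneg)
qed

lemma L2_vec_norm_nonneg: "0 \<le> L2_vec_norm T F"
  by (simp add: L2_vec_norm_def)

text \<open>The Cauchy--Schwarz inequality against the constant \<open>1\<close>, obtained from the nonnegative variance
\<open>\<integral> (T |F| - I)\<^sup>2\<close> with \<open>I = \<integral> |F|\<close>.\<close>

lemma integral_norm_le_L2_vec_norm:
  fixes F :: "real \<Rightarrow> real^'n"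
  assumes F: "F \<in> L2_vec T" and "T > 0"
  shows "(LINT t|leb T. norm (F t)) \<le> sqrt T * L2_vec_norm T F"
proof -
  define I where "I = (LINT t|leb T. norm (F t))"
  have int: "integrable (leb T) (\<lambda>t. norm (F t))" "integrable (leb T) (\<lambda>t. (norm (F t))\<^sup>2)"
    using L2_vec_integrable[OF F] L2_vec_sq_integrable(1)[OF F] by auto
  have vol: "measure (leb T) (space (leb T)) = T"
    using \<open>T > 0\<close> by (simp add: measure_restrict_space)
  have "0 \<le> (LINT t|leb T. (T * norm (F t) - I)\<^sup>2)" by simp
  also have "\<dots> = (LINT t|leb T. T\<^sup>2 * (norm (F t))\<^sup>2 - 2 * T * I * norm (F t) + I\<^sup>2)"
    by (simp add: power2_eq_square algebra_simps)
  also have "\<dots> = T\<^sup>2 * (L2_vec_norm T F)\<^sup>2 - 2 * T * I * I + T * I\<^sup>2"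
    using int integrable_leb_const[of T "I\<^sup>2"] vol by (simp add: L2_vec_sq_integrable(2)[OF F] I_def)
  also have "\<dots> = T * (T * (L2_vec_norm T F)\<^sup>2 - I\<^sup>2)"
    by (simp add: power2_eq_square algebra_simps)
  finally have "I\<^sup>2 \<le> T * (L2_vec_norm T F)\<^sup>2"
    using \<open>T > 0\<close> by (simp add: zero_le_mult_iff)
  also have "\<dots> = (sqrt T * L2_vec_norm T F)\<^sup>2"
    using \<open>T > 0\<close> by (simp add: power_mult_distrib)
  finally show ?thesis
    unfolding I_def using \<open>T > 0\<close> L2_vec_norm_nonneg[of T F] by (auto intro: power2_le_imp_le)
qed

lemma Linf_AE:
  assumes "f \<in> Linf T"
  shows "AE t in leb T. \<bar>f t\<bar> \<le> Linf_norm T f"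
  using esssup_AE[of "\<lambda>t. ereal \<bar>f t\<bar>" "leb T"]
proof eventually_elim
  case (elim t)
  with assms show ?case
    by (cases "esssup (leb T) (\<lambda>t. ereal \<bar>f t\<bar>)") (auto simp: Linf_def Linf_norm_def)
qed

lemma Linf_mat_AE:
  fixes P :: "real \<Rightarrow> real^'n^'n"
  assumes "P \<in> Linf_mat T"
  shows "AE t in leb T. \<forall>i j. \<bar>P t $ i $ j\<bar> \<le> Linf_mat_norm T P"
proof -
  have "AE t in leb T. \<bar>P t $ i $ j\<bar> \<le> Linf_mat_norm T P" for i j
  proof -
    have "Linf_norm T (\<lambda>t. P t $ i $ j) \<le> Linf_mat_norm T P"
      unfolding Linf_mat_norm_def by (rule Max_ge) (auto intro: range_eqI[of _ _ "(i, j)"])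
    moreover have "AE t in leb T. \<bar>P t $ i $ j\<bar> \<le> Linf_norm T (\<lambda>t. P t $ i $ j)"
      using assms by (intro Linf_AE) (auto simp: Linf_mat_def)
    ultimately show ?thesis by (auto elim!: eventually_mono)
  qed
  then show ?thesis by (simp add: AE_all_countable)
qed

text \<open>A Lipschitz constant for matrices with entries bounded by \<open>M\<close>; the absolute value and the summand \<open>1\<close>
make it positive for every real \<open>M\<close>, so that it may be divided by.\<close>

definition lip_const :: "'n::finite itself \<Rightarrow> real \<Rightarrow> real" where
  "lip_const _ M = real CARD('n) ^ 2 * \<bar>M\<bar> + 1"

lemma lip_const_pos: "lip_const TYPE('n::finite) M > 0"
  by (simp add: lip_const_def add_nonneg_pos)

lemma norm_matrix_vector_le:
  fixes A :: "real^'n^'n"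
  assumes "\<And>i j. \<bar>A $ i $ j\<bar> \<le> M"
  shows "norm (A *v x) \<le> lip_const TYPE('n) M * norm x"
proof -
  have M: "M \<ge> 0" using assms order_trans[OF abs_ge_zero] by blast
  have "norm (A *v x) \<le> (\<Sum>i\<in>UNIV. \<bar>(A *v x) $ i\<bar>)" by (rule norm_le_l1_cart)
  also have "\<dots> \<le> (\<Sum>i\<in>(UNIV :: 'n set). \<Sum>j\<in>(UNIV :: 'n set). M * norm x)"
  proof (rule sum_mono)
    fix i
    have "\<bar>(A *v x) $ i\<bar> \<le> (\<Sum>j\<in>UNIV. \<bar>A $ i $ j * x $ j\<bar>)"
      unfolding matrix_vector_mult_def by simp
    also have "\<dots> \<le> (\<Sum>j\<in>(UNIV :: 'n set). M * norm x)"
      unfolding abs_mult using assms component_le_norm_cart[of x] M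
      by (intro sum_mono mult_mono) auto
    finally show "\<bar>(A *v x) $ i\<bar> \<le> (\<Sum>j\<in>(UNIV :: 'n set). M * norm x)" .
  qed
  also have "\<dots> \<le> lip_const TYPE('n) M * norm x"
    using M by (simp add: lip_const_def power2_eq_square algebra_simps)
  finally show ?thesis .
qed

lemma matrix_mult_L2_vec:
  fixes P :: "real \<Rightarrow> real^'n^'n"
  assumes P: "P \<in> Linf_mat T" and g: "g \<in> L2_vec T"
  shows "(\<lambda>t. P t *v g t) \<in> L2_vec T"
proof -
  have "(\<lambda>t. P t $ i $ j * g t $ j) \<in> L2 T" for i j
  proof (rule L2_bounded_mult)
    show "(\<lambda>t. P t $ i $ j) \<in> borel_measurable (leb T)"
      using P by (auto simp: Linf_mat_def Linf_def)
    show "AE t in leb T. \<bar>P t $ i $ j\<bar> \<le> Linf_mat_norm T P"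
      using Linf_mat_AE[OF P] by eventually_elim auto
  qed (use g in \<open>auto simp: L2_vec_def\<close>)
  then show ?thesis
    by (auto simp: L2_vec_def matrix_vector_mult_def intro!: L2_sum)
qed

section \<open>The initial value problem as a Volterra equation\<close>

locale fractional_order =
  fixes T \<alpha> :: real
  assumes T_gt_0: "T > 0" and \<alpha>_gt_1: "1 < \<alpha>" and \<alpha>_le_2: "\<alpha> \<le> 2"

text \<open>Here \<open>\<alpha> > 1\<close> enters: only then is \<open>r\<^sub>+\<^sup>\<alpha>\<^sup>-\<^sup>1\<close> continuous at \<open>0\<close>.\<close>

sublocale fractional_order \<subseteq> volterra_kernel "\<lambda>r. tpow (\<alpha> - 1) r / Gamma \<alpha>" T "T powr (\<alpha> - 1) / Gamma \<alpha>"
proof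
  have G: "Gamma \<alpha> > 0" using \<alpha>_gt_1 by (intro Gamma_real_pos) auto
  show "T > 0" by (rule T_gt_0)
  show "T powr (\<alpha> - 1) / Gamma \<alpha> > 0" using T_gt_0 G by simp
  show "continuous_on UNIV (\<lambda>r. tpow (\<alpha> - 1) r / Gamma \<alpha>)"
    unfolding tpow_def using \<alpha>_gt_1 less_imp_neq[OF G] by (intro continuous_on_divide continuous_on_powr' continuous_intros) auto
  show "tpow (\<alpha> - 1) r / Gamma \<alpha> = 0" if "r \<le> 0" for r
    using that by (simp add: tpow_eq_0)
  show "\<bar>tpow (\<alpha> - 1) r / Gamma \<alpha>\<bar> \<le> T powr (\<alpha> - 1) / Gamma \<alpha>" if "r \<le> T" for r
    using that G \<alpha>_gt_1 T_gt_0 by (simp add: divide_right_mono tpow_le)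
qed

context fractional_order
begin

lemma V_component:
  fixes w :: "real \<Rightarrow> real^'n"
  assumes "integrable (leb T) w" "t \<le> T"
  shows "V w t $ i = J \<alpha> (\<lambda>s. w s $ i) t"
  unfolding V_def J_eq_tpow[OF assms(2)]
  using integral_bounded_linear[OF bounded_linear_vec_nth integrable_V[OF assms], of i] by simp

text \<open>Whichever function is selected as the fractional derivative, it is a preimage under \<open>J \<alpha>\<close> and satisfies the differential equation.\<close>

lemma is_solutionD:
  fixes u :: "real \<Rightarrow> real^'n"
  assumes sol: "is_solution \<alpha> T P F a0 a1 u"
  defines "w \<equiv> frac_deriv_vec \<alpha> T (\<lambda>s. u s - a0 - s *\<^sub>R a1)"
  shows "w \<in> L2_vec T"
    and "AE t in leb T. u t = a0 + t *\<^sub>R a1 + V w t"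
    and "AE t in leb T. w t = P t *v (a0 + t *\<^sub>R a1 + V w t) + F t"
proof -
  let ?d = "\<lambda>i. frac_deriv \<alpha> T (\<lambda>s. (u s - a0 - s *\<^sub>R a1) $ i)"
  have "?d i \<in> L2 T \<and> (AE t in leb T. (u t - a0 - t *\<^sub>R a1) $ i = J \<alpha> (?d i) t)" for i
  proof -
    have "\<exists>w. w \<in> L2 T \<and> (AE t in leb T. (u t - a0 - t *\<^sub>R a1) $ i = J \<alpha> w t)"
      using sol by (auto simp: is_solution_def H_vec_def H_def)
    from someI_ex[OF this] show ?thesis unfolding frac_deriv_def .
  qed
  then have w: "(\<lambda>t. w t $ i) \<in> L2 T"
    and Jw: "AE t in leb T. (u t - a0 - t *\<^sub>R a1) $ i = J \<alpha> (\<lambda>s. w s $ i) t" for i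
    unfolding w_def frac_deriv_vec_def by simp_all
  show L2: "w \<in> L2_vec T" using w by (simp add: L2_vec_def)
  have "AE t in leb T. \<forall>i. (u t - a0 - t *\<^sub>R a1) $ i = J \<alpha> (\<lambda>s. w s $ i) t"
    using Jw by (simp add: AE_all_countable)
  then show uV: "AE t in leb T. u t = a0 + t *\<^sub>R a1 + V w t"
    using AE_space
  proof eventually_elim
    case (elim t)
    then have "u t - a0 - t *\<^sub>R a1 = V w t"
      using V_component[OF L2_vec_integrable[OF L2], of t] by (simp add: vec_eq_iff)
    then show ?case by (simp add: algebra_simps)
  qed
  have "AE t in leb T. w t = P t *v u t + F t"
    using sol by (simp add: is_solution_def w_def)
  with uV show "AE t in leb T. w t = P t *v (a0 + t *\<^sub>R a1 + V w t) + F t"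
    by eventually_elim simp
qed

text \<open>The selected fractional derivative of \<open>V w\<close> is some preimage under \<open>J \<alpha>\<close>; injectivity of \<open>J \<alpha>\<close> makes it
equal to \<open>w\<close>.\<close>

lemma is_solutionI:
  fixes w :: "real \<Rightarrow> real^'n"
  assumes w: "w \<in> L2_vec T"
    and eq: "AE t in leb T. w t = P t *v (a0 + t *\<^sub>R a1 + V w t) + F t"
  shows "is_solution \<alpha> T P F a0 a1 (\<lambda>t. a0 + t *\<^sub>R a1 + V w t)" (is "is_solution \<alpha> T P F a0 a1 ?u")
proof -
  note int = L2_vec_integrable[OF w]
  have wi: "(\<lambda>t. w t $ i) \<in> L2 T" for i using w by (simp add: L2_vec_def)
  have "continuous_on {0..T} ?u" by (intro continuous_intros V_continuous int)
  then have u: "?u \<in> L2_vec T" by (rule L2_vec_continuous)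
  have shift: "(\<lambda>t. ?u t - a0 - t *\<^sub>R a1) = V w" by auto
  have J: "AE t in leb T. V w t $ i = J \<alpha> (\<lambda>s. w s $ i) t" for i
    using V_component[OF int] by (intro AE_I2) auto
  have "AE t in leb T. frac_deriv \<alpha> T (\<lambda>s. V w s $ i) t = w t $ i" for i
  proof -
    let ?d = "frac_deriv \<alpha> T (\<lambda>s. V w s $ i)"
    have "\<exists>d. d \<in> L2 T \<and> (AE t in leb T. V w t $ i = J \<alpha> d t)" using wi J by blast
    from someI_ex[OF this] have d: "?d \<in> L2 T" "AE t in leb T. V w t $ i = J \<alpha> ?d t"
      unfolding frac_deriv_def by blast+
    have "AE t in leb T. J \<alpha> ?d t = J \<alpha> (\<lambda>s. w s $ i) t"
      using d(2) J[of i] by eventually_elim simp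
    then show ?thesis
      by (rule J_inj[OF T_gt_0 less_imp_le[OF \<alpha>_gt_1] \<alpha>_le_2 L2_integrable[OF d(1)] L2_integrable[OF wi]])
  qed
  then have "AE t in leb T. \<forall>i. frac_deriv \<alpha> T (\<lambda>s. V w s $ i) t = w t $ i"
    by (simp add: AE_all_countable)
  then have "AE t in leb T. frac_deriv_vec \<alpha> T (V w) t = P t *v ?u t + F t"
    using eq by eventually_elim (simp add: frac_deriv_vec_def vec_eq_iff)
  moreover have "V w \<in> H_vec \<alpha> T" using J wi by (auto simp: H_vec_def H_def)
  ultimately show ?thesis unfolding is_solution_def shift using u by blast
qed

section \<open>Existence, uniqueness and the a priori estimate\<close>

lemma solution_exists:
  fixes P :: "real \<Rightarrow> real^'n^'n"
  assumes P: "P \<in> Linf_mat T" and F: "F \<in> L2_vec T"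
  shows "\<exists>u. is_solution \<alpha> T P F a0 a1 u"
proof -
  define \<Phi> where "\<Phi> s x = P s *v (a0 + s *\<^sub>R a1 + x) + F s" for s x
  have \<Phi>: "(\<lambda>s. \<Phi> s (g s)) \<in> L2_vec T" if "continuous_on UNIV g" for g
    unfolding \<Phi>_def
    by (intro L2_vec_add matrix_mult_L2_vec P F L2_vec_continuous continuous_intros
        continuous_on_subset[OF that]) auto
  let ?m = "lip_const TYPE('n) (Linf_mat_norm T P)"
  have lip: "AE s in leb T. \<forall>x y. norm (\<Phi> s x - \<Phi> s y) \<le> ?m * norm (x - y)"
    using Linf_mat_AE[OF P]
  proof eventually_elim
    case (elim s)
    have "\<Phi> s x - \<Phi> s y = P s *v (x - y)" for x y
      by (simp add: \<Phi>_def flip: matrix_vector_mult_diff_distrib)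
    then show ?case using norm_matrix_vector_le[of "P s"] elim by simp
  qed
  have "\<exists>g. continuous_on UNIV g \<and> (\<forall>t\<in>{0..T}. g t = V (\<lambda>s. \<Phi> s (g s)) t)"
    by (rule volterra_fixed_point[OF _ lip_const_pos lip]) (rule L2_vec_integrable[OF \<Phi>])
  then obtain g where g: "continuous_on UNIV g" "\<And>t. t \<in> {0..T} \<Longrightarrow> g t = V (\<lambda>s. \<Phi> s (g s)) t"
    by (elim exE conjE) simp
  show ?thesis
  proof (rule exI, rule is_solutionI[OF \<Phi>[OF g(1)]])
    show "AE t in leb T. \<Phi> t (g t) = P t *v (a0 + t *\<^sub>R a1 + V (\<lambda>s. \<Phi> s (g s)) t) + F t"
      using g(2) by (intro AE_I2) (simp add: \<Phi>_def)
  qed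
qed

text \<open>The difference of the two fractional derivatives solves the homogeneous Volterra equation, to which
Gronwall applies with \<open>f = 0\<close>.\<close>

lemma solution_unique:
  fixes P :: "real \<Rightarrow> real^'n^'n"
  assumes P: "P \<in> Linf_mat T"
    and u: "is_solution \<alpha> T P F a0 a1 u" and v: "is_solution \<alpha> T P F a0 a1 v"
  shows "AE t in leb T. v t = u t"
proof -
  let ?m = "lip_const TYPE('n) (Linf_mat_norm T P)"
  obtain w where w: "w \<in> L2_vec T" "AE t in leb T. u t = a0 + t *\<^sub>R a1 + V w t"
    "AE t in leb T. w t = P t *v (a0 + t *\<^sub>R a1 + V w t) + F t"
    using is_solutionD[OF u] by blast
  obtain w' where w': "w' \<in> L2_vec T" "AE t in leb T. v t = a0 + t *\<^sub>R a1 + V w' t"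
    "AE t in leb T. w' t = P t *v (a0 + t *\<^sub>R a1 + V w' t) + F t"
    using is_solutionD[OF v] by blast
  note int = L2_vec_integrable[OF w(1)] L2_vec_integrable[OF w'(1)]
  have "AE s in leb T. norm (w s - w' s) \<le> ?m * norm (V (\<lambda>s. w s - w' s) s) + 0"
    using w(3) w'(3) Linf_mat_AE[OF P] AE_space
  proof eventually_elim
    case (elim s)
    have "w s - w' s = P s *v (a0 + s *\<^sub>R a1 + V w s) - P s *v (a0 + s *\<^sub>R a1 + V w' s)"
      using elim(1,2) by (metis add_diff_cancel_right)
    also have "\<dots> = P s *v (V (\<lambda>s. w s - w' s) s)"
      using elim(4) by (simp add: V_diff[OF int] flip: matrix_vector_mult_diff_distrib)
    finally show ?case using norm_matrix_vector_le[of "P s"] elim(3) by simp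
  qed
  then have "norm (V (\<lambda>s. w s - w' s) t) \<le> 0" if "0 \<le> t" "t \<le> T" for t
    using volterra_gronwall[of "\<lambda>s. w s - w' s" "\<lambda>_. 0" ?m t] int that
    by (simp add: lip_const_pos)
  then have V_eq: "V w t = V w' t" if "0 \<le> t" "t \<le> T" for t
    using V_diff[OF int] that by force
  show ?thesis using w(2) w'(2) AE_space
    by eventually_elim (simp add: V_eq)
qed

text \<open>The constant \<open>B\<close> in the pointwise bound \<open>|w| \<le> B D + |F|\<close>, where \<open>D\<close> is the sum of the norms of the data.
The first summand comes from \<open>P (a0 + t a1)\<close>, the second from \<open>P (V w)\<close> and the Gronwall bound for
\<open>V w\<close>, whose last factor bounds the \<open>L\<^sup>1\<close> norm of the data.\<close>

definition apriori_const :: "real \<Rightarrow> real" where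
  "apriori_const m = (let c = T powr (\<alpha> - 1) / Gamma \<alpha> in
     m * (1 + T) + m * (2 * c * exp (2 * c * m * T) * (m * (1 + T) * T + sqrt T)))"

text \<open>Gronwall controls \<open>V w\<close> uniformly by the data, the equation then controls \<open>|w|\<close> by a constant plus \<open>|F|\<close>,
and \<open>(a + b)\<^sup>2 \<le> 2 a\<^sup>2 + 2 b\<^sup>2\<close> gives the \<open>L\<^sup>2\<close> norm of each component. The factor \<open>CARD('n)\<close> comes from
summing over the components.\<close>

lemma solution_bound:
  fixes P :: "real \<Rightarrow> real^'n^'n"
  assumes P: "P \<in> Linf_mat T" and F: "F \<in> L2_vec T" and u: "is_solution \<alpha> T P F a0 a1 u"
  shows "H_vec_norm \<alpha> T (\<lambda>t. u t - a0 - t *\<^sub>R a1)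
    \<le> real CARD('n) * sqrt (2 * (apriori_const (lip_const TYPE('n) (Linf_mat_norm T P)))\<^sup>2 * T + 2)
        * (norm a0 + norm a1 + L2_vec_norm T F)"
proof -
  define \<mu> where "\<mu> = lip_const TYPE('n) (Linf_mat_norm T P)"
  define c where "c = T powr (\<alpha> - 1) / Gamma \<alpha>"
  define D where "D = norm a0 + norm a1 + L2_vec_norm T F"
  define K where "K = apriori_const \<mu> * D"
  define w where "w = frac_deriv_vec \<alpha> T (\<lambda>s. u s - a0 - s *\<^sub>R a1)"
  note w = is_solutionD[OF u, folded w_def]
  have apriori_const_eq: "apriori_const \<mu> = \<mu> * (1 + T) + \<mu> * (2 * c * exp (2 * c * \<mu> * T) * (\<mu> * (1 + T) * T + sqrt T))"
    by (simp add: apriori_const_def Let_def c_def)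
  have \<mu>: "\<mu> > 0" by (simp add: \<mu>_def lip_const_pos)
  have c: "c > 0" unfolding c_def by (rule c_pos)
  have F0: "L2_vec_norm T F \<ge> 0" by (rule L2_vec_norm_nonneg)
  have D: "D \<ge> 0" "L2_vec_norm T F \<le> D" unfolding D_def using F0 by auto
  have a_le: "norm (a0 + s *\<^sub>R a1) \<le> (1 + T) * D" if "0 < s" "s < T" for s
  proof -
    have "norm (a0 + s *\<^sub>R a1) \<le> norm a0 + s * norm a1"
      using norm_triangle_ineq[of a0 "s *\<^sub>R a1"] that by simp
    also have "\<dots> \<le> D + T * D"
      unfolding D_def using that F0 by (intro add_mono mult_mono) auto
    finally show ?thesis by (simp add: algebra_simps)
  qed

  define f where "f s = \<mu> * ((1 + T) * D) + norm (F s)" for s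
  have w_le: "AE s in leb T. norm (w s) \<le> \<mu> * norm (V w s) + f s"
    using w(3) Linf_mat_AE[OF P] AE_space
  proof eventually_elim
    case (elim s)
    have "norm (w s) \<le> norm (P s *v (a0 + s *\<^sub>R a1 + V w s)) + norm (F s)"
      by (subst elim(1)) (rule norm_triangle_ineq)
    also have "norm (P s *v (a0 + s *\<^sub>R a1 + V w s)) \<le> \<mu> * norm (a0 + s *\<^sub>R a1 + V w s)"
      unfolding \<mu>_def using elim(2) by (intro norm_matrix_vector_le) auto
    also have "norm (a0 + s *\<^sub>R a1 + V w s) \<le> (1 + T) * D + norm (V w s)"
      using norm_triangle_ineq[of "a0 + s *\<^sub>R a1" "V w s"] a_le[of s] elim(3) by auto
    finally show ?case using \<mu> by (simp add: f_def algebra_simps)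
  qed
  have f_int: "integrable (leb T) f"
    unfolding f_def using L2_vec_integrable[OF F]
    by (intro Bochner_Integration.integrable_add integrable_leb_const integrable_norm)
  have f_nonneg: "f s \<ge> 0" for s unfolding f_def using \<mu> D T_gt_0 by simp
  have vol: "measure (leb T) (space (leb T)) = T"
    using T_gt_0 by (simp add: measure_restrict_space)
  have "(LINT s|leb T. f s) = \<mu> * ((1 + T) * D) * T + (LINT s|leb T. norm (F s))"
    unfolding f_def using integrable_leb_const[of T "\<mu> * ((1 + T) * D)"] L2_vec_integrable[OF F] vol by simp
  also have "\<dots> \<le> \<mu> * ((1 + T) * D) * T + sqrt T * D"
    using order_trans[OF integral_norm_le_L2_vec_norm[OF F T_gt_0] mult_left_mono[OF D(2)]] T_gt_0 by simp
  finally have f_le: "(LINT s|leb T. f s) \<le> (\<mu> * (1 + T) * T + sqrt T) * D"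
    by (simp add: algebra_simps)
  have V_le: "norm (V w t) \<le> 2 * c * exp (2 * c * \<mu> * T) * ((\<mu> * (1 + T) * T + sqrt T) * D)"
    if "0 \<le> t" "t \<le> T" for t
  proof -
    have "norm (V w t) \<le> 2 * c * exp (2 * c * \<mu> * T) * (LINT s|leb T. f s)"
      unfolding c_def
      using L2_vec_integrable[OF w(1)] f_int f_nonneg \<mu> that w_le by (rule volterra_gronwall)
    also have "\<dots> \<le> 2 * c * exp (2 * c * \<mu> * T) * ((\<mu> * (1 + T) * T + sqrt T) * D)"
      using f_le c by (intro mult_left_mono) auto
    finally show ?thesis .
  qed
  have "AE s in leb T. norm (w s) \<le> K + norm (F s)"
    using w_le AE_space
  proof eventually_elim
    case (elim s)
    have "\<mu> * norm (V w s) \<le> \<mu> * (2 * c * exp (2 * c * \<mu> * T) * ((\<mu> * (1 + T) * T + sqrt T) * D))"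
      using V_le[of s] \<mu> elim by (intro mult_left_mono) auto
    then have "norm (w s) \<le> \<mu> * (2 * c * exp (2 * c * \<mu> * T) * ((\<mu> * (1 + T) * T + sqrt T) * D))
        + \<mu> * ((1 + T) * D) + norm (F s)"
      using elim(1) unfolding f_def by linarith
    also have "\<dots> = K + norm (F s)"
      by (simp add: K_def apriori_const_eq algebra_simps)
    finally show ?case .
  qed
  then have sq: "AE s in leb T. (w s $ i)\<^sup>2 \<le> 2 * K\<^sup>2 + 2 * (norm (F s))\<^sup>2" for i
  proof eventually_elim
    case (elim s)
    then have "\<bar>w s $ i\<bar>\<^sup>2 \<le> (K + norm (F s))\<^sup>2"
      using component_le_norm_cart[of "w s" i] by (intro power_mono) auto
    also have "\<dots> \<le> 2 * K\<^sup>2 + 2 * (norm (F s))\<^sup>2"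
      using sum_squares_bound[of K "norm (F s)"] by (simp add: power2_sum)
    finally show ?case by simp
  qed
  have "L2_norm T (\<lambda>t. w t $ i) \<le> sqrt (2 * (apriori_const \<mu>)\<^sup>2 * T + 2) * D" for i
  proof -
    note F2 = L2_vec_sq_integrable[OF F]
    have "(LINT s|leb T. (w s $ i)\<^sup>2) \<le> (LINT s|leb T. 2 * K\<^sup>2 + 2 * (norm (F s))\<^sup>2)"
      using w(1) F2(1) integrable_leb_const[of T "2 * K\<^sup>2"]
      by (intro integral_mono_AE sq) (auto simp: L2_vec_def L2_def)
    also have "\<dots> = 2 * K\<^sup>2 * T + 2 * (L2_vec_norm T F)\<^sup>2"
      using F2 integrable_leb_const[of T "2 * K\<^sup>2"] vol by simp
    also have "\<dots> \<le> 2 * K\<^sup>2 * T + 2 * D\<^sup>2"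
      using F0 D by (simp add: power_mono)
    also have "\<dots> = (2 * (apriori_const \<mu>)\<^sup>2 * T + 2) * D\<^sup>2"
      by (simp add: K_def power_mult_distrib algebra_simps)
    finally have "L2_norm T (\<lambda>t. w t $ i) \<le> sqrt ((2 * (apriori_const \<mu>)\<^sup>2 * T + 2) * D\<^sup>2)"
      unfolding L2_norm_def by (rule real_sqrt_le_mono)
    then show ?thesis using D by (simp add: real_sqrt_mult)
  qed
  then have "(\<Sum>i\<in>(UNIV :: 'n set). L2_norm T (\<lambda>t. w t $ i))
      \<le> real CARD('n) * (sqrt (2 * (apriori_const \<mu>)\<^sup>2 * T + 2) * D)"
    by (rule sum_bounded_above)
  moreover have "H_vec_norm \<alpha> T (\<lambda>t. u t - a0 - t *\<^sub>R a1) = L2_set (\<lambda>i. L2_norm T (\<lambda>t. w t $ i)) UNIV"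
    by (simp add: H_vec_norm_def H_norm_def w_def frac_deriv_vec_def)
  moreover have "\<dots> \<le> (\<Sum>i\<in>UNIV. L2_norm T (\<lambda>t. w t $ i))"
    by (rule L2_set_le_sum) (simp add: L2_norm_def)
  ultimately show ?thesis by (simp add: D_def \<mu>_def mult.assoc)
qed

end

theorem theorem2p1:
  fixes T \<alpha> :: real
  assumes "T > 0" and "1 < \<alpha>" and "\<alpha> \<le> 2"
  shows "\<exists>C :: real \<Rightarrow> real. (\<forall>M. C M > 0) \<and>
    (\<forall>(P :: real \<Rightarrow> real^'n^'n) (F :: real \<Rightarrow> real^'n) (a0 :: real^'n) (a1 :: real^'n).
       P \<in> Linf_mat T \<longrightarrow> F \<in> L2_vec T \<longrightarrow>
         (\<exists>u. is_solution \<alpha> T P F a0 a1 u \<and>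
              (\<forall>v. is_solution \<alpha> T P F a0 a1 v \<longrightarrow> (AE t in leb T. v t = u t))) \<and>
         (\<forall>u. is_solution \<alpha> T P F a0 a1 u \<longrightarrow>
              H_vec_norm \<alpha> T (\<lambda>t. u t - a0 - t *\<^sub>R a1)
                \<le> C (Linf_mat_norm T P) * (norm a0 + norm a1 + L2_vec_norm T F)))"
proof -
  interpret fractional_order T \<alpha> by standard (use assms in auto)
  let ?C = "\<lambda>M. real CARD('n) * sqrt (2 * (apriori_const (lip_const TYPE('n) M))\<^sup>2 * T + 2)"
  have pos: "?C M > 0" for M
    using assms by (simp add: add_nonneg_pos)
  show ?thesis
  proof (rule exI[of _ ?C], intro conjI allI impI)
    fix P :: "real \<Rightarrow> real^'n^'n" and F :: "real \<Rightarrow> real^'n" and a0 a1 :: "real^'n"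
    assume P: "P \<in> Linf_mat T" and F: "F \<in> L2_vec T"
    obtain u where "is_solution \<alpha> T P F a0 a1 u"
      using solution_exists[OF P F, of a0 a1] by (elim exE)
    then show "\<exists>u. is_solution \<alpha> T P F a0 a1 u \<and>
        (\<forall>v. is_solution \<alpha> T P F a0 a1 v \<longrightarrow> (AE t in leb T. v t = u t))"
      by (intro exI[of _ u] conjI allI impI) (assumption | rule solution_unique[OF P])+
    show "H_vec_norm \<alpha> T (\<lambda>t. u t - a0 - t *\<^sub>R a1)
        \<le> ?C (Linf_mat_norm T P) * (norm a0 + norm a1 + L2_vec_norm T F)"
      if "is_solution \<alpha> T P F a0 a1 u" for u
      by (rule solution_bound[OF P F that])
  qed (rule pos)
qed

end
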